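(* Every finite threshold graph is a monoid graph.
   Context: All monoids and graphs are finite and nonempty. For a monoid $M$ and $C\subseteq M$ (possibly empty), $\underline{\mathrm{Cay}}(M,C)$ is the simple undirected graph with vertex set $M$ in which distinct $x,y$ are adjacent if and only if $y=xc$ or $x=yc$ for some $c\in C$. A monoid graph is a simple undirected graph isomorphic to $\underline{\mathrm{Cay}}(M,C)$ for some monoid $M$ and some $C\subseteq M$. A graph $G=(V,E)$ is a threshold graph if there exist non-negative reals $t$ and $w_v$ ($v\in V$) such that for every $U\subseteq V$ we have $\sum_{v\in U}w_v\leq t$ if and only if $U$ is an independent set. Equivalently, it can be obtained from the one-vertex graph by repeatedly adding an isolated vertex or a vertex adjacent to all the others. *)

theory Defs
  imports
    "HOL-Algebra.Group"
    "Graph_Theory.Digraph_Isomorphism"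
    "Graph_Theory.Pair_Digraph"
begin

text \<open>
  Finite simple undirected graphs are the graphs satisfying \<^locale>\<open>pair_graph\<close>: finite vertex set,
  and a symmetric, irreflexive set of arcs on it (so an edge is represented by its two orientations).
  Since arcs are pairs of vertices, \<^const>\<open>digraph_iso\<close> between such graphs is the usual
  isomorphism of simple graphs. \<^locale>\<open>pair_graph\<close> admits the graph without vertices, so
  nonemptiness has to be required separately.
\<close>

definition Cay :: "('a, 'm) monoid_scheme \<Rightarrow> 'a set \<Rightarrow> 'a pair_pre_digraph" where
  "Cay M C = \<lparr> pverts = carrier M,
     parcs = {(x, y). x \<in> carrier M \<and> y \<in> carrier M \<and> x \<noteq> y \<and>
                (\<exists>c\<in>C. y = x \<otimes>\<^bsub>M\<^esub> c \<or> x = y \<otimes>\<^bsub>M\<^esub> c)} \<rparr>"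

text \<open>
  A definition cannot quantify existentially over the type of the monoid elements. As only finite
  monoids are considered, carriers in \<^typ>\<open>nat\<close> suffice; see \<open>monoid_graphI\<close> below, which
  covers monoids over an arbitrary type.
\<close>

definition monoid_graph :: "'v pair_pre_digraph \<Rightarrow> bool" where
  "monoid_graph G \<longleftrightarrow> pair_graph G \<and>
     (\<exists>(M :: nat monoid) C. monoid M \<and> finite (carrier M) \<and> C \<subseteq> carrier M \<and>
        digraph_iso (with_proj G) (with_proj (Cay M C)))"

definition independent_set :: "'v pair_pre_digraph \<Rightarrow> 'v set \<Rightarrow> bool" where
  "independent_set G U \<longleftrightarrow> U \<subseteq> pverts G \<and> (\<forall>u\<in>U. \<forall>v\<in>U. (u, v) \<notin> parcs G)"

definition threshold_graph :: "'v pair_pre_digraph \<Rightarrow> bool" where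
  "threshold_graph G \<longleftrightarrow> pair_graph G \<and> pverts G \<noteq> {} \<and>
     (\<exists>(t :: real) (w :: 'v \<Rightarrow> real). t \<ge> 0 \<and> (\<forall>v\<in>pverts G. w v \<ge> 0) \<and>
        (\<forall>U. U \<subseteq> pverts G \<longrightarrow> ((\<Sum>v\<in>U. w v) \<le> t \<longleftrightarrow> independent_set G U)))"

lemma pair_graph_Cay:
  assumes "finite (carrier M)"
  shows "pair_graph (Cay M C)"
proof -
  have "finite (parcs (Cay M C))"
    by (rule finite_subset[of _ "carrier M \<times> carrier M"]) (auto simp: Cay_def assms)
  then show ?thesis
    by unfold_locales (auto simp: Cay_def assms symmetric_def arcs_ends_conv sym_def)
qed

lemma digraph_iso_with_projD:
  fixes G :: "'v pair_pre_digraph" and H :: "'w pair_pre_digraph"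
  assumes "digraph_iso (with_proj G) (with_proj H)"
  obtains f where "bij_betw f (pverts G) (pverts H)" "parcs H = map_prod f f ` parcs G"
proof -
  obtain h where h: "pre_digraph.digraph_isomorphism (with_proj G) h"
    and eq: "with_proj H = app_iso h (with_proj G)"
    using assms unfolding digraph_iso_def by blast
  have V: "pverts H = iso_verts h ` pverts G" and A: "parcs H = iso_arcs h ` parcs G"
    and T: "iso_tail h = fst" and D: "iso_head h = snd"
    using eq by (auto simp: with_proj_def app_iso_def)
  have "iso_arcs h a = map_prod (iso_verts h) (iso_verts h) a" if "a \<in> parcs G" for a
    using h that by (auto simp: pre_digraph.digraph_isomorphism_def T D prod_eq_iff)
  then have "parcs H = map_prod (iso_verts h) (iso_verts h) ` parcs G"
    unfolding A by (rule image_cong[OF refl])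
  moreover have "bij_betw (iso_verts h) (pverts G) (pverts H)"
    using h by (simp add: pre_digraph.digraph_isomorphism_def bij_betw_def V)
  ultimately show ?thesis using that by blast
qed

lemma digraph_iso_with_projI:
  fixes G :: "'v pair_pre_digraph" and H :: "'w pair_pre_digraph"
  assumes "pair_graph G" "bij_betw f (pverts G) (pverts H)" "parcs H = map_prod f f ` parcs G"
  shows "digraph_iso (with_proj G) (with_proj H)"
proof -
  interpret pair_graph G by fact
  let ?h = "\<lparr> iso_verts = f, iso_arcs = map_prod f f, iso_head = snd, iso_tail = fst \<rparr>"
  have inj: "inj_on f (pverts G)" using assms(2) by (simp add: bij_betw_def)
  have sub: "parcs G \<subseteq> pverts G \<times> pverts G" using in_arcsD1 in_arcsD2 by auto
  have "inj_on (map_prod f f) (parcs G)"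
    by (rule inj_on_subset[OF map_prod_inj_on[OF inj inj] sub])
  then have "pre_digraph.digraph_isomorphism (with_proj G) ?h"
    using inj wf_digraph_axioms by (simp add: pre_digraph.digraph_isomorphism_def)
  moreover have "with_proj H = app_iso ?h (with_proj G)"
    using assms(2,3) by (simp add: app_iso_def with_proj_def bij_betw_def)
  ultimately show ?thesis unfolding digraph_iso_def by blast
qed

lemma monoid_graphI:
  fixes M :: "('a, 'm) monoid_scheme" and G :: "'v pair_pre_digraph"
  assumes G: "pair_graph G" and M: "monoid M" and fin: "finite (carrier M)"
    and C: "C \<subseteq> carrier M" and iso: "digraph_iso (with_proj G) (with_proj (Cay M C))"
  shows "monoid_graph G"
proof -
  interpret monoid M by fact
  obtain h :: "'a \<Rightarrow> nat" where inj: "inj_on h (carrier M)"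
    using finite_imp_inj_to_nat_seg[OF fin] by blast
  define g where "g = the_inv_into (carrier M) h"
  have gh: "g (h x) = x" if "x \<in> carrier M" for x
    using that inj by (simp add: g_def the_inv_into_f_f)
  define N :: "nat monoid" where
    "N = \<lparr> carrier = h ` carrier M, monoid.mult = (\<lambda>a b. h (g a \<otimes>\<^bsub>M\<^esub> g b)), one = h \<one>\<^bsub>M\<^esub> \<rparr>"
  have cN: "carrier N = h ` carrier M"
    and mN: "a \<otimes>\<^bsub>N\<^esub> b = h (g a \<otimes>\<^bsub>M\<^esub> g b)" for a b
    by (simp_all add: N_def)
  have N: "monoid N"
    by (rule monoidI) (auto simp: N_def gh m_assoc)
  have heq: "h x = h y \<longleftrightarrow> x = y" if "x \<in> carrier M" "y \<in> carrier M" for x y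
    using inj that by (auto dest: inj_onD)
  have adj: "(h x, h y) \<in> parcs (Cay N (h ` C)) \<longleftrightarrow> (x, y) \<in> parcs (Cay M C)"
    if "x \<in> carrier M" "y \<in> carrier M" for x y
  proof -
    have "h y = h x \<otimes>\<^bsub>N\<^esub> h c \<longleftrightarrow> y = x \<otimes>\<^bsub>M\<^esub> c" "h x = h y \<otimes>\<^bsub>N\<^esub> h c \<longleftrightarrow> x = y \<otimes>\<^bsub>M\<^esub> c" if "c \<in> C" for c
      using \<open>x \<in> _\<close> \<open>y \<in> _\<close> that C by (auto simp: mN gh heq subset_iff)
    then show ?thesis using that by (auto simp: Cay_def cN heq)
  qed
  have arcs: "parcs (Cay N (h ` C)) = map_prod h h ` parcs (Cay M C)" (is "?L = ?R")
  proof
    show "?L \<subseteq> ?R"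
    proof
      fix p assume p: "p \<in> ?L"
      then obtain x y where "x \<in> carrier M" "y \<in> carrier M" "p = (h x, h y)"
        by (auto simp: Cay_def cN)
      with p adj show "p \<in> ?R" by force
    qed
    show "?R \<subseteq> ?L"
    proof
      fix p assume "p \<in> ?R"
      then obtain x y where xy: "(x, y) \<in> parcs (Cay M C)" "p = (h x, h y)" by auto
      then have "x \<in> carrier M" "y \<in> carrier M" by (auto simp: Cay_def)
      with xy adj show "p \<in> ?L" by simp
    qed
  qed
  obtain f where f: "bij_betw f (pverts G) (pverts (Cay M C))"
    and fa: "parcs (Cay M C) = map_prod f f ` parcs G"
    using digraph_iso_with_projD[OF iso] .
  have "bij_betw h (pverts (Cay M C)) (pverts (Cay N (h ` C)))"
    using inj by (simp add: Cay_def cN bij_betw_def)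
  then have "bij_betw (h \<circ> f) (pverts G) (pverts (Cay N (h ` C)))"
    using f by (rule bij_betw_trans[rotated])
  moreover have "parcs (Cay N (h ` C)) = map_prod (h \<circ> f) (h \<circ> f) ` parcs G"
    unfolding arcs fa by (simp add: image_image map_prod.compositionality)
  ultimately have "digraph_iso (with_proj G) (with_proj (Cay N (h ` C)))"
    by (rule digraph_iso_with_projI[OF G])
  moreover have "finite (carrier N)" "h ` C \<subseteq> carrier N" using fin C by (auto simp: cN)
  ultimately show ?thesis
    unfolding monoid_graph_def using G N by blast
qed

end

theory Submission
  imports Defs "HOL-Library.Product_Lexorder"
begin

text \<open>
  A finite chain is a monoid under \<open>max\<close>, and in its Cayley graph with respect to \<open>C\<close> two elements
  \<open>a < b\<close> are adjacent iff \<open>b \<in> C\<close>. So it suffices to order the vertices of a threshold graph such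
  that each of them is adjacent to all or to none of its predecessors. Two distinct vertices
  \<open>x\<close>, \<open>y\<close> are adjacent iff \<open>w x + w y > t\<close>, and ordering by \<open>\<bar>w v - t / 2\<bar>\<close> does this: a vertex is
  adjacent to its predecessors iff its weight exceeds \<open>t / 2\<close>.
\<close>

definition max_monoid :: "'a::linorder set \<Rightarrow> 'a monoid" where
  "max_monoid A = \<lparr> carrier = A, monoid.mult = max, one = Min A \<rparr>"

lemma max_monoid_simps [simp]:
  "carrier (max_monoid A) = A"
  "a \<otimes>\<^bsub>max_monoid A\<^esub> b = max a b"
  "\<one>\<^bsub>max_monoid A\<^esub> = Min A"
  by (simp_all add: max_monoid_def)

lemma monoid_max_monoid:
  assumes "finite A" "A \<noteq> {}"
  shows "monoid (max_monoid A)"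
proof -
  have "max a b \<in> A" if "a \<in> A" "b \<in> A" for a b
    using that by (simp add: max_def)
  then show ?thesis
    using assms by (intro monoidI) (auto simp: max.assoc max_absorb1 max_absorb2)
qed

text \<open>If \<open>a < b\<close>, then \<open>a = max b c\<close> is impossible, and
  \<open>b = max a c\<close> forces \<open>c = b\<close>.\<close>

lemma parcs_Cay_max_monoid:
  assumes "C \<subseteq> A"
  shows "parcs (Cay (max_monoid A) C) =
    {(a, b). a \<in> A \<and> b \<in> A \<and> (a < b \<and> b \<in> C \<or> b < a \<and> a \<in> C)}"
  using assms by (auto simp: Cay_def max_def split: if_splits)

text \<open>The map \<open>f\<close> is itself the isomorphism onto the Cayley graph, with the image
  of \<open>D\<close> as connection set. Its values lie in any linear order, so lexicographic tuples
  can serve as sort keys.\<close>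

lemma monoid_graph_if_ordered:
  fixes G :: "'v pair_pre_digraph" and f :: "'v \<Rightarrow> 'a::linorder"
  assumes G: "pair_graph G" and ne: "pverts G \<noteq> {}" and inj: "inj_on f (pverts G)"
    and D: "D \<subseteq> pverts G"
    and adj: "\<And>x y. \<lbrakk>x \<in> pverts G; y \<in> pverts G; f x < f y\<rbrakk> \<Longrightarrow> (x, y) \<in> parcs G \<longleftrightarrow> y \<in> D"
  shows "monoid_graph G"
proof -
  interpret pair_graph G by fact
  let ?A = "f ` pverts G" and ?C = "f ` D"
  have sub: "?C \<subseteq> ?A" using D by auto
  have C: "f x \<in> ?C \<longleftrightarrow> x \<in> D" if "x \<in> pverts G" for x
    using inj D that by (auto dest: inj_onD)
  let ?H = "Cay (max_monoid ?A) ?C"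
  have arc: "(x, y) \<in> parcs G \<longleftrightarrow> (f x, f y) \<in> parcs ?H"
    if xy: "x \<in> pverts G" "y \<in> pverts G" for x y
  proof (cases "f x" "f y" rule: linorder_cases)
    case less
    then show ?thesis using adj[OF xy] C[OF xy(2)] xy by (auto simp: parcs_Cay_max_monoid[OF sub])
  next
    case equal
    then have "x = y" using inj xy by (auto dest: inj_onD)
    then show ?thesis using no_loops' by (fastforce simp: parcs_Cay_max_monoid[OF sub])
  next
    case greater
    then show ?thesis using adj[OF xy(2,1)] C[OF xy(1)] xy arcs_symmetric
      by (auto simp: parcs_Cay_max_monoid[OF sub])
  qed
  have "parcs ?H = map_prod f f ` parcs G" (is "?L = ?R")
  proof
    show "?L \<subseteq> ?R"
    proof
      fix p assume p: "p \<in> ?L"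
      then obtain x y where xy: "x \<in> pverts G" "y \<in> pverts G" "p = (f x, f y)"
        unfolding parcs_Cay_max_monoid[OF sub] by blast
      with p arc show "p \<in> ?R" by force
    qed
    show "?R \<subseteq> ?L"
    proof
      fix p assume "p \<in> ?R"
      then obtain x y where xy: "(x, y) \<in> parcs G" "p = (f x, f y)" by auto
      then have V: "x \<in> pverts G" "y \<in> pverts G" using in_arcsD1 in_arcsD2 by auto
      with xy arc[OF V] show "p \<in> ?L" by simp
    qed
  qed
  moreover have "bij_betw f (pverts G) (pverts ?H)"
    using inj by (simp add: Cay_def bij_betw_def)
  ultimately have iso: "digraph_iso (with_proj G) (with_proj ?H)"
    by (intro digraph_iso_with_projI G)
  show ?thesis
    by (rule monoid_graphI[OF G _ _ _ iso]) (use ne sub in \<open>auto intro: monoid_max_monoid\<close>)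
qed

text \<open>Only the sets \<open>{x, y}\<close> need to be tested: without loops, such a set is
  independent iff it is not an edge.\<close>

lemma threshold_graph_weights:
  assumes "threshold_graph G"
  obtains t :: real and w where
    "\<And>x y. \<lbrakk>x \<in> pverts G; y \<in> pverts G; x \<noteq> y\<rbrakk> \<Longrightarrow> (x, y) \<in> parcs G \<longleftrightarrow> w x + w y > t"
proof -
  obtain t :: real and w where
    tw: "\<And>U. U \<subseteq> pverts G \<Longrightarrow> (\<Sum>v\<in>U. w v) \<le> t \<longleftrightarrow> independent_set G U"
    using assms unfolding threshold_graph_def by blast
  interpret pair_graph G using assms by (simp add: threshold_graph_def)
  have "(x, y) \<in> parcs G \<longleftrightarrow> w x + w y > t" if "x \<in> pverts G" "y \<in> pverts G" "x \<noteq> y" for x y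
  proof -
    have "independent_set G {x, y} \<longleftrightarrow> (x, y) \<notin> parcs G"
      using that no_loops' arcs_symmetric by (fastforce simp: independent_set_def)
    then show ?thesis using tw[of "{x, y}"] that by auto
  qed
  then show ?thesis by (rule that)
qed

theorem corollary4p3:
  fixes G :: "'v pair_pre_digraph"
  assumes "threshold_graph G"
  shows "monoid_graph G"
proof -
  have G: "pair_graph G" and ne: "pverts G \<noteq> {}"
    using assms by (auto simp: threshold_graph_def)
  interpret pair_graph G by fact
  obtain t :: real and w where
    adj: "\<And>x y. \<lbrakk>x \<in> pverts G; y \<in> pverts G; x \<noteq> y\<rbrakk> \<Longrightarrow> (x, y) \<in> parcs G \<longleftrightarrow> w x + w y > t"
    using threshold_graph_weights[OF assms] by blast
  obtain e :: "'v \<Rightarrow> nat" where e: "inj_on e (pverts G)"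
    using finite_imp_inj_to_nat_seg[of "pverts G"] by auto
  \<comment> \<open>Weights \<open>t / 2 + d\<close> and \<open>t / 2 - d\<close> sum to exactly \<open>t\<close>, a non-edge, so on equal distances the
    light vertices have to come last; \<open>e\<close> only breaks the remaining ties.\<close>
  define f where "f v = (\<bar>w v - t / 2\<bar>, w v \<le> t / 2, e v)" for v
  show ?thesis
  proof (rule monoid_graph_if_ordered[OF G ne])
    show "inj_on f (pverts G)"
      using e by (auto simp: f_def inj_on_def)
    show "{v \<in> pverts G. w v > t / 2} \<subseteq> pverts G" by auto
    show "(x, y) \<in> parcs G \<longleftrightarrow> y \<in> {v \<in> pverts G. w v > t / 2}"
      if xy: "x \<in> pverts G" "y \<in> pverts G" and less: "f x < f y" for x y
    proof -
      have "x \<noteq> y" using less by auto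
      \<comment> \<open>Let d be the distance of \<open>w y\<close> from \<open>t / 2\<close>; that
        of \<open>w x\<close> is at most d. A light \<open>y\<close> has weight \<open>t / 2\<close>
        - d, so the sum is at most \<open>t\<close>. A heavy \<open>y\<close> has weight
        \<open>t / 2\<close> + d, so the sum is at least \<open>t\<close>; equality would make
        \<open>x\<close> light at distance d and put it after \<open>y\<close>.\<close>
      moreover have "w x + w y > t \<longleftrightarrow> w y > t / 2"
        using less by (auto simp: f_def less_prod_simp abs_if field_simps split: if_splits)
      ultimately show ?thesis using adj xy by simp
    qed
  qed
qed

end
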